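(* Let $p\in(0,1)$. (i) Let $\alpha\in(0,\infty)$ and $X\in\mathcal X_\alpha$. Then $\inf_{t\in\mathbb R}B_\alpha(X;p)(t)$ is attained at some $t_{\mathrm{opt}}\in\mathbb R$ and hence $$Q_\alpha(X;p)=\min_{t\in\mathbb R}B_\alpha(X;p)(t)=B_\alpha(X;p)(t_{\mathrm{opt}});$$ moreover, for any $s\in\mathbb R$ and any $\tilde p\in(p,1)$, necessarily $t_{\mathrm{opt}}\in[t_{\min},t_{\max}]$ (for every such minimizer $t_{\mathrm{opt}}$), where $$t_{\max}:=B_\alpha(X;p)(s),\quad t_{\min}:=\min(t_{0,\min},t_{1,\min}),\quad t_{0,\min}:=Q_0(X;\tilde p),\quad t_{1,\min}:=\frac{(\tilde p/p)^{1/\alpha}\,t_{0,\min}-t_{\max}}{(\tilde p/p)^{1/\alpha}-1}.$$ (ii) Let $\alpha=\infty$ and $X\in\mathcal X_\infty$. Then $\inf_{t\in(0,\infty)}B_\infty(X;p)(t)$ is attained and hence $Q_\infty(X;p)=\min_{t\in(0,\infty)}B_\infty(X;p)(t)$, unless $$x_*<\infty\quad\text{and}\quad p\le p_*.\qquad( * )$$ On the other hand, if conditions $( * )$ hold, then $B_\infty(X;p)(t)$ is strictly increasing in $t>0$ and hence $\inf_{t\in(0,\infty)}B_\infty(X;p)(t)$ is not attained; rather, $$Q_\infty(X;p)=\inf_{t>0}B_\infty(X;p)(t)=B_\infty(X;p)(0+)=x_*.$$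
   Context: For real $u$, $u_+:=\max(0,u)$, $u_+^\alpha:=(u_+)^\alpha$; $\|Z\|_\alpha:=(\mathsf E|Z|^\alpha)^{1/\alpha}$ for $\alpha\in(0,\infty)$. Define $h_0(u)=\mathsf I\{u\ge0\}$ (indicator), $h_\alpha(u)=(1+u/\alpha)_+^\alpha$ for $0<\alpha<\infty$, and $h_\infty(u)=e^u$, $u\in\mathbb R$. For a random variable $X$, $x\in\mathbb R$, $\alpha\in[0,\infty]$ and $p\in(0,1)$ put $$P_\alpha(X;x):=\inf_{\lambda\in(0,\infty)}\mathsf E\,h_\alpha(\lambda(X-x)),\qquad Q_\alpha(X;p):=\inf\{x\in\mathbb R:P_\alpha(X;x)<p\};$$ in particular $Q_0(X;p)=\inf\{x\in\mathbb R:\mathsf P(X\ge x)<p\}$. Also $$B_\alpha(X;p)(t):=t+p^{-1/\alpha}\|(X-t)_+\|_\alpha\ \ (\alpha\in(0,\infty),\ t\in\mathbb R),\qquad B_\infty(X;p)(t):=t\ln\frac{\mathsf E e^{X/t}}p\ \ (t\in(0,\infty)).$$ For $\alpha\in(0,\infty)$, $\mathcal X_\alpha$ is the set of real-valued random variables $X$ with $\mathsf E X_+^\alpha<\infty$; $\mathcal X_\infty$ is the set of those with $\mathsf E e^{\lambda X}<\infty$ for some real $\lambda>0$. $x_*:=\sup\operatorname{supp}X\in(-\infty,\infty]$ ($\operatorname{supp}X$ is the support of the distribution of $X$) and $p_*:=\mathsf P(X=x_* )$. $f(0+)$ denotes the right limit of $f$ at $0$. *)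

theory Defs
  imports "HOL-Probability.Probability"
begin

text \<open>
  The index \<open>\<alpha> \<in> [0, \<infinity>]\<close> is an element of \<^typ>\<open>ennreal\<close>. Random variables are Borel
  measurable real functions on a probability space \<open>M\<close>, which is an explicit argument throughout.
\<close>

definition hfun :: "ennreal \<Rightarrow> real \<Rightarrow> real" where
  "hfun \<alpha> u =
    (if \<alpha> = 0 then indicator {0..} u
     else if \<alpha> = \<infinity> then exp u
     else max 0 (1 + u / enn2real \<alpha>) powr enn2real \<alpha>)"

text \<open>The expectation is the nonnegative integral, so it may be infinite for some \<open>l\<close>.\<close>

definition Pfun :: "'a measure \<Rightarrow> ennreal \<Rightarrow> ('a \<Rightarrow> real) \<Rightarrow> real \<Rightarrow> ennreal" where
  "Pfun M \<alpha> X x = (INF l\<in>{0<..}. \<integral>\<^sup>+ \<omega>. ennreal (hfun \<alpha> (l * (X \<omega> - x))) \<partial>M)"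

text \<open>The infimum is taken in the extended reals, so that no convention is needed for sets
  that are empty or unbounded below.\<close>

definition Qfun :: "'a measure \<Rightarrow> ennreal \<Rightarrow> ('a \<Rightarrow> real) \<Rightarrow> real \<Rightarrow> ereal" where
  "Qfun M \<alpha> X p = (INF x\<in>{x. Pfun M \<alpha> X x < ennreal p}. ereal x)"

lemma Qfun_0:
  assumes X: "X \<in> borel_measurable M"
  shows "Qfun M 0 X p =
    (INF x\<in>{x. emeasure M {\<omega> \<in> space M. x \<le> X \<omega>} < ennreal p}. ereal x)"
proof -
  have "Pfun M 0 X x = emeasure M {\<omega> \<in> space M. x \<le> X \<omega>}" for x
  proof -
    have "(\<integral>\<^sup>+ \<omega>. ennreal (hfun 0 (l * (X \<omega> - x))) \<partial>M)
        = emeasure M {\<omega> \<in> space M. x \<le> X \<omega>}" if "0 < l" for l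
    proof -
      have "(\<integral>\<^sup>+ \<omega>. ennreal (hfun 0 (l * (X \<omega> - x))) \<partial>M)
          = (\<integral>\<^sup>+ \<omega>. indicator {\<omega> \<in> space M. x \<le> X \<omega>} \<omega> \<partial>M)"
        using that by (intro nn_integral_cong)
          (auto simp: hfun_def zero_le_mult_iff split: split_indicator)
      also have "\<dots> = emeasure M {\<omega> \<in> space M. x \<le> X \<omega>}"
        using X by (intro nn_integral_indicator) measurable
      finally show ?thesis .
    qed
    then have "Pfun M 0 X x = (INF l\<in>{0::real<..}. emeasure M {\<omega> \<in> space M. x \<le> X \<omega>})"
      unfolding Pfun_def by (intro INF_cong) auto
    then show ?thesis by simp
  qed
  then show ?thesis by (simp add: Qfun_def)
qed

definition XX :: "'a measure \<Rightarrow> ennreal \<Rightarrow> ('a \<Rightarrow> real) set" where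
  "XX M \<alpha> = {X \<in> borel_measurable M.
    if \<alpha> = \<infinity> then \<exists>l>0. integrable M (\<lambda>\<omega>. exp (l * X \<omega>))
    else integrable M (\<lambda>\<omega>. max 0 (X \<omega>) powr enn2real \<alpha>)}"

text \<open>The Bochner integral makes this \<open>0\<close> when \<open>\<bar>Z\<bar>\<^sup>\<alpha>\<close> is not integrable. For
  \<open>X \<in> XX M \<alpha>\<close> with \<open>0 < \<alpha> < \<infinity>\<close>, every \<open>(X - t)\<^sub>+\<^sup>\<alpha>\<close> is integrable.\<close>

definition Lnorm :: "'a measure \<Rightarrow> real \<Rightarrow> ('a \<Rightarrow> real) \<Rightarrow> real" where
  "Lnorm M \<alpha> Z = (\<integral>\<omega>. \<bar>Z \<omega>\<bar> powr \<alpha> \<partial>M) powr (1 / \<alpha>)"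

definition Bfin :: "'a measure \<Rightarrow> real \<Rightarrow> ('a \<Rightarrow> real) \<Rightarrow> real \<Rightarrow> real \<Rightarrow> real" where
  "Bfin M \<alpha> X p t = t + p powr (- 1 / \<alpha>) * Lnorm M \<alpha> (\<lambda>\<omega>. max 0 (X \<omega> - t))"

definition eln :: "ennreal \<Rightarrow> ereal" where
  "eln y = (if y = 0 then - \<infinity> else if y = \<infinity> then \<infinity> else ereal (ln (enn2real y)))"

text \<open>For \<open>X \<in> XX M \<infinity>\<close>, the value is \<open>\<infinity>\<close> at those \<open>t > 0\<close> for which \<open>e\<^bsup>X/t\<^esup>\<close>
  has infinite expectation.\<close>

definition Binf :: "'a measure \<Rightarrow> ('a \<Rightarrow> real) \<Rightarrow> real \<Rightarrow> real \<Rightarrow> ereal" where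
  "Binf M X p t = ereal t * eln ((\<integral>\<^sup>+ \<omega>. ennreal (exp (X \<omega> / t)) \<partial>M) / ennreal p)"

definition supp :: "'a measure \<Rightarrow> ('a \<Rightarrow> real) \<Rightarrow> real set" where
  "supp M X = {x. \<forall>U. open U \<longrightarrow> x \<in> U \<longrightarrow> measure (distr M borel X) U > 0}"

definition xstar :: "'a measure \<Rightarrow> ('a \<Rightarrow> real) \<Rightarrow> ereal" where
  "xstar M X = (SUP x\<in>supp M X. ereal x)"

definition pstar :: "'a measure \<Rightarrow> ('a \<Rightarrow> real) \<Rightarrow> real" where
  "pstar M X = measure M {\<omega> \<in> space M. ereal (X \<omega>) = xstar M X}"

end

theory Submission
  imports Defs
begin

text \<open>
  For finite \<open>\<alpha>\<close>, the substitution \<open>t = x - \<alpha> / \<lambda>\<close> turns \<open>h\<^sub>\<alpha> (\<lambda> (X - x))\<close> into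
  \<open>(X - t)\<^sub>+\<^sup>\<alpha> / (x - t)\<^sup>\<alpha>\<close>, so \<open>P\<^sub>\<alpha> (X; x) < p\<close> holds iff \<open>B\<^sub>\<alpha> (X; p) (t) < x\<close> for some \<open>t\<close>; for
  \<open>\<alpha> = \<infinity>\<close> the same holds with \<open>t = 1 / \<lambda>\<close>. Hence the quantile is the infimum of \<open>B\<close>. If
  \<open>P(X \<ge> x) \<ge> q > p\<close>, a Markov bound gives \<open>B(t) \<ge> t + (q/p)\<^bsup>1/\<alpha>\<^esup> (x - t)\<close> for \<open>t \<le> x\<close>, resp.
  \<open>B(t) \<ge> x + t ln (q/p)\<close>; this confines sublevel sets, and (semi)continuity yields a minimizer.
  For \<open>\<alpha> = \<infinity>\<close> the sublevel sets can still reach down to \<open>0\<close>, which is excluded once some value of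
  \<open>B\<close> lies below \<open>x\<^sub>*\<close>. Writing \<open>B(t) = x\<^sub>* + t ln (g(t)/p)\<close> with the increasing function
  \<open>g(t) = E e\<^bsup>(X - x\<^sub>*)/t\<^esup>\<close> and \<open>g(0+) = p\<^sub>*\<close>, this happens if \<open>p\<^sub>* < p\<close>, whereas \<open>p \<le> p\<^sub>*\<close> forces
  \<open>g > p\<close>.
\<close>

section \<open>The quantile as an infimum of \<open>B\<close>\<close>

text \<open>The hypothesis says that the set defining the quantile is the union of the open rays
  above the values \<open>B t\<close>, so its infimum is that of \<open>B\<close>, attained or not.
  Both finite and infinite index use it.\<close>

lemma Qfun_eq_INF:
  fixes B :: "real \<Rightarrow> ereal"
  assumes "\<And>x. Pfun M \<alpha> X x < ennreal p \<longleftrightarrow> (\<exists>t\<in>T. B t < ereal x)"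
  shows "Qfun M \<alpha> X p = (INF t\<in>T. B t)"
proof (rule antisym)
  show "Qfun M \<alpha> X p \<le> (INF t\<in>T. B t)"
  proof (rule INF_greatest)
    fix t assume t: "t \<in> T"
    show "Qfun M \<alpha> X p \<le> B t"
    proof (rule ccontr)
      assume "\<not> Qfun M \<alpha> X p \<le> B t"
      \<comment> \<open>\<open>B t\<close> may be infinite, whereas the set defining the quantile
        consists of reals; hence a real \<open>z\<close> is inserted strictly between.\<close>
      then obtain z where z: "B t < ereal z" "ereal z < Qfun M \<alpha> X p"
        using ereal_dense2[of "B t" "Qfun M \<alpha> X p"] by (auto simp: not_le)
      have "Qfun M \<alpha> X p \<le> ereal z"
        unfolding Qfun_def using assms t z(1) by (intro INF_lower) auto
      with z(2) show False by simp
    qed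
  qed
  show "(INF t\<in>T. B t) \<le> Qfun M \<alpha> X p"
    unfolding Qfun_def
  proof (rule INF_greatest)
    fix x assume "x \<in> {x. Pfun M \<alpha> X x < ennreal p}"
    then obtain t where "t \<in> T" "B t < ereal x" using assms by auto
    then show "(INF t\<in>T. B t) \<le> ereal x"
      by (meson INF_lower2 less_imp_le)
  qed
qed

section \<open>Finite index: bounds and continuity of \<open>B\<close>\<close>

text \<open>Supplies one dominating function for all \<open>t\<close> in a bounded range:
  \<open>x - t\<close> is at most twice the larger of \<open>max 0 x\<close> and \<open>K\<close>,
  and the power of a maximum is at most the sum of the powers. This treats \<alpha> below and above
  1 alike.\<close>

lemma max_powr_le:
  fixes x t K \<alpha> :: real
  assumes "0 < \<alpha>" "\<bar>t\<bar> \<le> K"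
  shows "max 0 (x - t) powr \<alpha> \<le> 2 powr \<alpha> * (max 0 x powr \<alpha> + K powr \<alpha>)"
proof -
  define m where "m = max (max 0 x) K"
  have "max 0 (x - t) powr \<alpha> \<le> (2 * m) powr \<alpha>"
    using assms by (intro powr_mono2) (auto simp: m_def)
  also have "\<dots> = 2 powr \<alpha> * m powr \<alpha>"
    by (simp add: powr_mult m_def)
  also have "m powr \<alpha> \<le> max 0 x powr \<alpha> + K powr \<alpha>"
    by (auto simp: m_def max_def)
  finally show ?thesis by simp
qed

lemma powr_inverse_less_iff:
  fixes a d \<alpha> :: real
  assumes "0 < \<alpha>" "0 \<le> a" "0 < d"
  shows "a powr (1 / \<alpha>) < d \<longleftrightarrow> a < d powr \<alpha>"
proof
  assume "a powr (1 / \<alpha>) < d"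
  then have "(a powr (1 / \<alpha>)) powr \<alpha> < d powr \<alpha>"
    using assms by (intro powr_less_mono2) auto
  then show "a < d powr \<alpha>" using assms by (simp add: powr_powr)
next
  assume "a < d powr \<alpha>"
  then have "a powr (1 / \<alpha>) < (d powr \<alpha>) powr (1 / \<alpha>)"
    using assms by (intro powr_less_mono2) auto
  then show "a powr (1 / \<alpha>) < d" using assms by (simp add: powr_powr)
qed

text \<open>With \<open>p\<close> under the root, a comparison of \<open>B\<close> with a level is
  freed of the root by one application of \<open>powr_inverse_less_iff\<close>.\<close>

lemma Bfin_eq:
  assumes "0 < p" "0 < \<alpha>"
  shows "Bfin M \<alpha> X p t = t + ((\<integral>\<omega>. max 0 (X \<omega> - t) powr \<alpha> \<partial>M) / p) powr (1 / \<alpha>)"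
  using assms by (simp add: Bfin_def Lnorm_def powr_divide powr_minus_divide)

lemma Bfin_ge:
  assumes "0 < p" "0 < \<alpha>"
  shows "t \<le> Bfin M \<alpha> X p t"
  using assms by (simp add: Bfin_eq)

context prob_space
begin

lemma integrable_max_powr:
  fixes X :: "'a \<Rightarrow> real"
  assumes [measurable]: "X \<in> borel_measurable M"
    and "integrable M (\<lambda>\<omega>. max 0 (X \<omega>) powr \<alpha>)" "0 < \<alpha>"
  shows "integrable M (\<lambda>\<omega>. max 0 (X \<omega> - t) powr \<alpha>)"
proof (rule Bochner_Integration.integrable_bound)
  show "integrable M (\<lambda>\<omega>. 2 powr \<alpha> * (max 0 (X \<omega>) powr \<alpha> + \<bar>t\<bar> powr \<alpha>))"
    using assms by auto
  show "AE \<omega> in M. norm (max 0 (X \<omega> - t) powr \<alpha>)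
      \<le> norm (2 powr \<alpha> * (max 0 (X \<omega>) powr \<alpha> + \<bar>t\<bar> powr \<alpha>))"
    using max_powr_le[OF \<open>0 < \<alpha>\<close>, of t "\<bar>t\<bar>"] by auto
qed auto

lemma continuous_on_Bfin:
  fixes X :: "'a \<Rightarrow> real"
  assumes [measurable]: "X \<in> borel_measurable M"
    and int: "integrable M (\<lambda>\<omega>. max 0 (X \<omega>) powr \<alpha>)" and "0 < \<alpha>" "0 < p"
  shows "continuous_on UNIV (Bfin M \<alpha> X p)"
proof -
  have "isCont (\<lambda>t. \<integral>\<omega>. max 0 (X \<omega> - t) powr \<alpha> \<partial>M) a" for a
  proof (rule continuous_at_sequentiallyI)
    fix u :: "nat \<Rightarrow> real"
    assume u: "u \<longlonglongrightarrow> a"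
    \<comment> \<open>A convergent sequence is bounded, so a single \<open>K\<close> in
      \<open>max_powr_le\<close> dominates all members of the sequence.\<close>
    then have "Bseq u" by (simp add: convergentI convergent_imp_Bseq)
    then obtain K where K: "\<And>n. \<bar>u n\<bar> \<le> K" unfolding Bseq_def by auto
    show "(\<lambda>n. \<integral>\<omega>. max 0 (X \<omega> - u n) powr \<alpha> \<partial>M) \<longlonglongrightarrow> (\<integral>\<omega>. max 0 (X \<omega> - a) powr \<alpha> \<partial>M)"
    proof (rule integral_dominated_convergence)
      show "integrable M (\<lambda>\<omega>. 2 powr \<alpha> * (max 0 (X \<omega>) powr \<alpha> + K powr \<alpha>))"
        using int by auto
      show "AE \<omega> in M. norm (max 0 (X \<omega> - u n) powr \<alpha>)
          \<le> 2 powr \<alpha> * (max 0 (X \<omega>) powr \<alpha> + K powr \<alpha>)" for n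
        using max_powr_le[OF \<open>0 < \<alpha>\<close> K] by auto
      show "AE \<omega> in M. (\<lambda>n. max 0 (X \<omega> - u n) powr \<alpha>) \<longlonglongrightarrow> max 0 (X \<omega> - a) powr \<alpha>"
        using u \<open>0 < \<alpha>\<close> by (intro AE_I2 tendsto_powr2 tendsto_intros) auto
    qed auto
  qed
  \<comment> \<open>The expectation may vanish at \<open>a\<close>; the root is still continuous at
    base 0 because its exponent is positive.\<close>
  then have "isCont (\<lambda>t. t + ((\<integral>\<omega>. max 0 (X \<omega> - t) powr \<alpha> \<partial>M) / p) powr (1 / \<alpha>)) a" for a
    using \<open>0 < \<alpha>\<close> \<open>0 < p\<close> unfolding isCont_def
    by (intro tendsto_add tendsto_powr2 tendsto_divide tendsto_intros) auto
  then show ?thesis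
    using assms(3,4) by (simp add: Bfin_eq continuous_on_eq_continuous_at cong: isCont_cong)
qed

text \<open>Markov's inequality: on the event \<open>x \<le> X \<omega>\<close> the integrand is at
  least \<open>(x - t) powr \<alpha>\<close>. For \<open>p < q\<close> the coefficient of
  \<open>x - t\<close> exceeds 1, so the bound tends to infinity as \<open>t\<close> tends to minus
  infinity.\<close>

lemma Bfin_ge_quantile:
  fixes X :: "'a \<Rightarrow> real"
  assumes [measurable]: "X \<in> borel_measurable M"
    and int: "integrable M (\<lambda>\<omega>. max 0 (X \<omega>) powr \<alpha>)" and "0 < \<alpha>" "0 < p" "0 < q"
    and q: "q \<le> prob {\<omega> \<in> space M. x \<le> X \<omega>}" and "t \<le> x"
  shows "t + (q / p) powr (1 / \<alpha>) * (x - t) \<le> Bfin M \<alpha> X p t"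
proof -
  let ?A = "{\<omega> \<in> space M. x \<le> X \<omega>}"
  have "q * (x - t) powr \<alpha> \<le> prob ?A * (x - t) powr \<alpha>"
    using q by (intro mult_right_mono) auto
  also have "\<dots> = (\<integral>\<omega>. indicator ?A \<omega> * (x - t) powr \<alpha> \<partial>M)"
    by simp
  also have "\<dots> \<le> (\<integral>\<omega>. max 0 (X \<omega> - t) powr \<alpha> \<partial>M)"
  proof (rule integral_mono)
    show "integrable M (\<lambda>\<omega>. max 0 (X \<omega> - t) powr \<alpha>)"
      by (rule integrable_max_powr) fact+
    show "indicator ?A \<omega> * (x - t) powr \<alpha> \<le> max 0 (X \<omega> - t) powr \<alpha>" for \<omega>
      using \<open>0 < \<alpha>\<close> \<open>t \<le> x\<close> by (auto split: split_indicator intro!: powr_mono2)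
  qed (auto simp: emeasure_eq_measure)
  finally have "(q / p * (x - t) powr \<alpha>) powr (1 / \<alpha>)
      \<le> ((\<integral>\<omega>. max 0 (X \<omega> - t) powr \<alpha> \<partial>M) / p) powr (1 / \<alpha>)"
    using \<open>0 < \<alpha>\<close> \<open>0 < p\<close> \<open>0 < q\<close> by (intro powr_mono2) (auto simp: divide_right_mono)
  moreover have "(q / p * (x - t) powr \<alpha>) powr (1 / \<alpha>) = (q / p) powr (1 / \<alpha>) * (x - t)"
  proof -
    have "(q / p * (x - t) powr \<alpha>) powr (1 / \<alpha>)
        = (q / p) powr (1 / \<alpha>) * ((x - t) powr \<alpha>) powr (1 / \<alpha>)"
      by (rule powr_mult)
    then show ?thesis
      using \<open>0 < \<alpha>\<close> \<open>t \<le> x\<close> by (simp add: powr_powr)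
  qed
  ultimately show ?thesis
    using \<open>0 < \<alpha>\<close> \<open>0 < p\<close> by (simp add: Bfin_eq)
qed

section \<open>Tail probabilities and the quantile of index 0\<close>

lemma prob_ge_small:
  fixes X :: "'a \<Rightarrow> real"
  assumes [measurable]: "X \<in> borel_measurable M" and "0 < e"
  obtains x where "prob {\<omega> \<in> space M. x \<le> X \<omega>} < e"
proof -
  have "(\<lambda>n. prob {\<omega> \<in> space M. real n \<le> X \<omega>}) \<longlonglongrightarrow> prob (\<Inter>n. {\<omega> \<in> space M. real n \<le> X \<omega>})"
    by (rule finite_Lim_measure_decseq) (auto simp: decseq_def)
  also have "(\<Inter>n. {\<omega> \<in> space M. real n \<le> X \<omega>}) = {}"
    by (auto simp: not_le) (meson not_less reals_Archimedean2)
  finally have "eventually (\<lambda>n. prob {\<omega> \<in> space M. real n \<le> X \<omega>} < e) sequentially"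
    using \<open>0 < e\<close> by (intro order_tendstoD) auto
  then show ?thesis using that by (auto simp: eventually_sequentially)
qed

lemma prob_ge_large:
  fixes X :: "'a \<Rightarrow> real"
  assumes [measurable]: "X \<in> borel_measurable M" and "q < 1"
  obtains x where "q < prob {\<omega> \<in> space M. x \<le> X \<omega>}"
proof -
  obtain x where x: "prob {\<omega> \<in> space M. x \<le> - X \<omega>} < 1 - q"
    using prob_ge_small[of "\<lambda>\<omega>. - X \<omega>" "1 - q"] assms by auto
  have "1 - prob {\<omega> \<in> space M. x \<le> - X \<omega>} = prob {\<omega> \<in> space M. \<not> x \<le> - X \<omega>}"
    by (intro prob_neg[symmetric]) auto
  also have "\<dots> \<le> prob {\<omega> \<in> space M. - x \<le> X \<omega>}"
    by (intro finite_measure_mono) auto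
  finally have "q < prob {\<omega> \<in> space M. - x \<le> X \<omega>}" using x by simp
  then show ?thesis by (rule that)
qed

text \<open>The tail \<open>G\<close> is decreasing and takes values on both sides of
  \<open>q\<close>, which makes the quantile real. It is also left-continuous, so
  \<open>q \<le> G x\<close> for all \<open>x < z\<close> passes to \<open>z\<close> itself, the
  point at which the Markov bound is later applied.\<close>

lemma Qfun_0_quantile:
  fixes X :: "'a \<Rightarrow> real"
  assumes X[measurable]: "X \<in> borel_measurable M" and "0 < q" "q < 1"
  obtains z where "Qfun M 0 X q = ereal z" "q \<le> prob {\<omega> \<in> space M. z \<le> X \<omega>}"
proof -
  define G where "G x = prob {\<omega> \<in> space M. x \<le> X \<omega>}" for x
  have Q: "Qfun M 0 X q = (INF x\<in>{x. G x < q}. ereal x)"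
    using \<open>0 < q\<close> by (simp add: Qfun_0[OF X] G_def emeasure_eq_measure ennreal_less_iff)
  have anti: "G y \<le> G x" if "x \<le> y" for x y
    unfolding G_def using that by (intro finite_measure_mono) auto
  obtain a where a: "G a < q" using prob_ge_small[OF X \<open>0 < q\<close>] by (auto simp: G_def)
  obtain b where b: "q < G b" using prob_ge_large[OF X \<open>q < 1\<close>] by (auto simp: G_def)
  have lower: "ereal b \<le> Qfun M 0 X q"
    unfolding Q
  proof (rule INF_greatest)
    fix x assume "x \<in> {x. G x < q}"
    then show "ereal b \<le> ereal x" using b anti[of x b] by (cases "b \<le> x") auto
  qed
  have upper: "Qfun M 0 X q \<le> ereal a"
    unfolding Q using a by (intro INF_lower) auto
  obtain z where z: "Qfun M 0 X q = ereal z"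
    using lower upper by (cases "Qfun M 0 X q") auto
  have below: "q \<le> G x" if "x < z" for x
  proof (rule ccontr)
    assume "\<not> q \<le> G x"
    then have "Qfun M 0 X q \<le> ereal x" unfolding Q by (intro INF_lower) auto
    with z that show False by simp
  qed
  have "(\<lambda>n. G (z - 1 / real (Suc n))) \<longlonglongrightarrow> prob (\<Inter>n. {\<omega> \<in> space M. z - 1 / real (Suc n) \<le> X \<omega>})"
    unfolding G_def
  proof (rule finite_Lim_measure_decseq)
    show "decseq (\<lambda>n. {\<omega> \<in> space M. z - 1 / real (Suc n) \<le> X \<omega>})"
      unfolding decseq_def
    proof safe
      fix m n :: nat and \<omega>
      assume "m \<le> n" and *: "z - 1 / real (Suc n) \<le> X \<omega>"
      then have "1 / real (Suc n) \<le> 1 / real (Suc m)" by (intro divide_left_mono) auto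
      with * show "z - 1 / real (Suc m) \<le> X \<omega>" by linarith
    qed
  qed auto
  also have "(\<Inter>n. {\<omega> \<in> space M. z - 1 / real (Suc n) \<le> X \<omega>}) = {\<omega> \<in> space M. z \<le> X \<omega>}"
  proof safe
    fix \<omega> assume "\<omega> \<in> (\<Inter>n. {\<omega> \<in> space M. z - 1 / real (Suc n) \<le> X \<omega>})"
    then have *: "z - X \<omega> \<le> 1 / real (Suc n)" "\<omega> \<in> space M" for n by (auto simp: algebra_simps)
    show "z \<le> X \<omega>"
    proof (rule ccontr)
      assume "\<not> z \<le> X \<omega>"
      then obtain n where "1 / real (Suc n) < z - X \<omega>" using nat_approx_posE[of "z - X \<omega>"] by auto
      with *(1)[of n] show False by simp
    qed
  next
    fix \<omega> n assume "z \<le> X \<omega>"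
    moreover have "0 \<le> 1 / real (Suc n)" by simp
    ultimately show "z - 1 / real (Suc n) \<le> X \<omega>" by linarith
  qed auto
  finally have "q \<le> prob {\<omega> \<in> space M. z \<le> X \<omega>}"
    by (rule tendsto_lowerbound) (auto intro!: always_eventually below)
  with z show ?thesis using that by blast
qed

section \<open>Finite index: from \<open>P\<close> to \<open>B\<close>, and minimizers\<close>

text \<open>The maps taking \<open>l\<close> to \<open>x - \<alpha> / l\<close> and \<open>t\<close>
  to \<open>\<alpha> / (x - t)\<close> are mutually inverse between \<open>0 < l\<close> and
  \<open>t < x\<close>. An infimum lies strictly below \<open>p\<close> iff one of its members does,
  so the two conditions can be matched pointwise.\<close>

lemma Pfun_less_iff_Bfin:
  fixes X :: "'a \<Rightarrow> real"
  assumes [measurable]: "X \<in> borel_measurable M"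
    and int: "integrable M (\<lambda>\<omega>. max 0 (X \<omega>) powr \<alpha>)" and "0 < \<alpha>" "0 < p"
  shows "Pfun M (ennreal \<alpha>) X x < ennreal p \<longleftrightarrow> (\<exists>t. Bfin M \<alpha> X p t < x)"
proof -
  have *: "(\<integral>\<^sup>+ \<omega>. ennreal (hfun (ennreal \<alpha>) (\<alpha> / (x - t) * (X \<omega> - x))) \<partial>M) < ennreal p
      \<longleftrightarrow> Bfin M \<alpha> X p t < x" if "t < x" for t
  proof -
    let ?E = "\<integral>\<omega>. max 0 (X \<omega> - t) powr \<alpha> \<partial>M"
    have h: "hfun (ennreal \<alpha>) (\<alpha> / (x - t) * (X \<omega> - x)) = max 0 (X \<omega> - t) powr \<alpha> / (x - t) powr \<alpha>"
      for \<omega>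
    proof -
      have "1 + \<alpha> / (x - t) * (X \<omega> - x) / \<alpha> = (X \<omega> - t) / (x - t)"
        using that \<open>0 < \<alpha>\<close> by (simp add: field_simps)
      moreover have "max 0 ((X \<omega> - t) / (x - t)) = max 0 (X \<omega> - t) / (x - t)"
        using that by (auto simp: max_def field_simps)
      ultimately show ?thesis
        using that \<open>0 < \<alpha>\<close> by (simp add: hfun_def powr_divide)
    qed
    have "(\<integral>\<^sup>+ \<omega>. ennreal (hfun (ennreal \<alpha>) (\<alpha> / (x - t) * (X \<omega> - x))) \<partial>M)
        = ennreal (?E / (x - t) powr \<alpha>)"
      unfolding h using integrable_max_powr[OF assms(1) int \<open>0 < \<alpha>\<close>, of t]
      by (subst nn_integral_eq_integral) auto
    then have "(\<integral>\<^sup>+ \<omega>. ennreal (hfun (ennreal \<alpha>) (\<alpha> / (x - t) * (X \<omega> - x))) \<partial>M) < ennreal p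
        \<longleftrightarrow> ?E / p < (x - t) powr \<alpha>"
      using that \<open>0 < p\<close> by (simp add: ennreal_less_iff field_simps)
    also have "\<dots> \<longleftrightarrow> (?E / p) powr (1 / \<alpha>) < x - t"
      using that \<open>0 < p\<close> \<open>0 < \<alpha>\<close> by (intro powr_inverse_less_iff[symmetric]) auto
    finally show ?thesis
      using \<open>0 < p\<close> \<open>0 < \<alpha>\<close> by (auto simp: Bfin_eq)
  qed
  show ?thesis
  proof
    assume "Pfun M (ennreal \<alpha>) X x < ennreal p"
    then obtain l where l: "0 < l"
      "(\<integral>\<^sup>+ \<omega>. ennreal (hfun (ennreal \<alpha>) (l * (X \<omega> - x))) \<partial>M) < ennreal p"
      by (auto simp: Pfun_def INF_less_iff)
    then have "Bfin M \<alpha> X p (x - \<alpha> / l) < x"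
      using *[of "x - \<alpha> / l"] \<open>0 < \<alpha>\<close> by simp
    then show "\<exists>t. Bfin M \<alpha> X p t < x" by blast
  next
    assume "\<exists>t. Bfin M \<alpha> X p t < x"
    then obtain t where t: "Bfin M \<alpha> X p t < x" by blast
    \<comment> \<open>Since \<open>B t\<close> is at least \<open>t\<close>, a witness automatically
      lies in the range of the substitution.\<close>
    then have "t < x" using Bfin_ge[of p \<alpha> t M X] \<open>0 < p\<close> \<open>0 < \<alpha>\<close> by simp
    with t * have "(\<integral>\<^sup>+ \<omega>. ennreal (hfun (ennreal \<alpha>) (\<alpha> / (x - t) * (X \<omega> - x))) \<partial>M) < ennreal p"
      by blast
    with \<open>t < x\<close> \<open>0 < \<alpha>\<close> show "Pfun M (ennreal \<alpha>) X x < ennreal p"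
      by (auto simp: Pfun_def INF_less_iff intro!: bexI[of _ "\<alpha> / (x - t)"])
  qed
qed

lemma Qfun_eq_INF_Bfin:
  fixes X :: "'a \<Rightarrow> real"
  assumes "X \<in> borel_measurable M" "integrable M (\<lambda>\<omega>. max 0 (X \<omega>) powr \<alpha>)" "0 < \<alpha>" "0 < p"
  shows "Qfun M (ennreal \<alpha>) X p = (INF t. ereal (Bfin M \<alpha> X p t))"
  by (rule Qfun_eq_INF) (simp add: Pfun_less_iff_Bfin[OF assms])

text \<open>For \<open>t < z\<close> the Markov bound gives \<open>t + c * (z - t) \<le> b\<close>,
  which is solved for \<open>t\<close> by dividing by \<open>c - 1\<close>; positivity of the latter
  is where \<open>p < q\<close> enters. The case \<open>z \<le> t\<close> accounts for the
  minimum.\<close>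

lemma Bfin_sublevel_ge:
  fixes X :: "'a \<Rightarrow> real"
  assumes "X \<in> borel_measurable M" "integrable M (\<lambda>\<omega>. max 0 (X \<omega>) powr \<alpha>)" "0 < \<alpha>" "0 < p"
    and "p < q" "q \<le> prob {\<omega> \<in> space M. z \<le> X \<omega>}" "Bfin M \<alpha> X p t \<le> b"
  defines "c \<equiv> (q / p) powr (1 / \<alpha>)"
  shows "1 < c" "min z ((c * z - b) / (c - 1)) \<le> t"
proof -
  have "1 powr (1 / \<alpha>) < (q / p) powr (1 / \<alpha>)"
    using assms by (intro powr_less_mono2) auto
  then show c: "1 < c" by (simp add: c_def)
  show "min z ((c * z - b) / (c - 1)) \<le> t"
  proof (cases "z \<le> t")
    case False
    then have "t + c * (z - t) \<le> b"
      using Bfin_ge_quantile[OF assms(1-4) _ assms(6), of t] assms by simp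
    then have "(c * z - b) / (c - 1) \<le> t"
      using c by (simp add: field_simps)
    then show ?thesis by simp
  qed simp
qed

text \<open>The sublevel set at level \<open>B 0\<close> lies in a compact interval: the Markov
  bound confines it from below, and \<open>t \<le> B t\<close> from above. A minimizer of the
  continuous \<open>B\<close> on that interval is global, because the interval contains 0 and
  outside it \<open>B\<close> exceeds its value at 0.\<close>

lemma Bfin_attained:
  fixes X :: "'a \<Rightarrow> real"
  assumes "X \<in> borel_measurable M" "integrable M (\<lambda>\<omega>. max 0 (X \<omega>) powr \<alpha>)" "0 < \<alpha>"
    "0 < p" "p < 1"
  shows "\<exists>s. \<forall>t. Bfin M \<alpha> X p s \<le> Bfin M \<alpha> X p t"
proof -
  let ?B = "Bfin M \<alpha> X p"
  obtain q where q: "p < q" "q < 1" using \<open>p < 1\<close> dense by blast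
  obtain z where z: "q < prob {\<omega> \<in> space M. z \<le> X \<omega>}"
    using prob_ge_large[OF assms(1) \<open>q < 1\<close>] by blast
  define b where "b = ?B 0"
  define a where "a = min z (((q / p) powr (1 / \<alpha>) * z - b) / ((q / p) powr (1 / \<alpha>) - 1))"
  have sub: "t \<in> {a..b}" if "?B t \<le> b" for t
  proof -
    have "a \<le> t" unfolding a_def
      using Bfin_sublevel_ge(2)[OF assms(1-4) q(1) less_imp_le[OF z] that] .
    moreover have "t \<le> b" using Bfin_ge[of p \<alpha> t M X] that assms by simp
    ultimately show ?thesis by simp
  qed
  then have 0: "0 \<in> {a..b}" by (auto simp: b_def)
  obtain s where s: "s \<in> {a..b}" "\<And>t. t \<in> {a..b} \<Longrightarrow> ?B s \<le> ?B t"
    using continuous_attains_inf[of "{a..b}" ?B] 0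
      continuous_on_subset[OF continuous_on_Bfin[OF assms(1-4)]] by auto
  have "?B s \<le> ?B t" for t
    using s(2)[of t] s(2)[OF 0] sub[of t] by (cases "?B t \<le> b") (auto simp: b_def)
  then show ?thesis by blast
qed

section \<open>Index infinity: level sets of \<open>B\<close> and attainment\<close>

lemma integral_exp_pos:
  fixes Y :: "'a \<Rightarrow> real"
  assumes "integrable M (\<lambda>\<omega>. exp (Y \<omega>))"
  shows "0 < (\<integral>\<omega>. exp (Y \<omega>) \<partial>M)"
proof -
  have "0 \<le> (\<integral>\<omega>. exp (Y \<omega>) \<partial>M)" by (intro Bochner_Integration.integral_nonneg) simp
  moreover have "(\<integral>\<omega>. exp (Y \<omega>) \<partial>M) \<noteq> 0"
  proof
    assume "(\<integral>\<omega>. exp (Y \<omega>) \<partial>M) = 0"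
    then have "AE \<omega> in M. exp (Y \<omega>) = 0"
      using integral_nonneg_eq_0_iff_AE[OF assms] by simp
    then show False by simp
  qed
  ultimately show ?thesis by linarith
qed

text \<open>The shift \<open>c\<close> is free because the factor \<open>exp (c / t)\<close> leaves
  the logarithm as the summand \<open>c\<close>. It is later taken to be 0, a level to compare with,
  or the right endpoint of the support.\<close>

lemma Binf_eq:
  fixes X :: "'a \<Rightarrow> real"
  assumes int: "integrable M (\<lambda>\<omega>. exp ((X \<omega> - c) / t))" and "0 < t" "0 < p"
  shows "Binf M X p t = ereal (c + t * ln ((\<integral>\<omega>. exp ((X \<omega> - c) / t) \<partial>M) / p))"
proof -
  let ?g = "\<integral>\<omega>. exp ((X \<omega> - c) / t) \<partial>M"
  have g: "0 < ?g" using integral_exp_pos[OF int] .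
  have "(\<integral>\<^sup>+ \<omega>. ennreal (exp (X \<omega> / t)) \<partial>M)
      = (\<integral>\<^sup>+ \<omega>. ennreal (exp (c / t) * exp ((X \<omega> - c) / t)) \<partial>M)"
    by (simp add: diff_divide_distrib flip: exp_add)
  also have "\<dots> = ennreal (exp (c / t) * ?g)"
    using int by (subst nn_integral_eq_integral) auto
  finally have "(\<integral>\<^sup>+ \<omega>. ennreal (exp (X \<omega> / t)) \<partial>M) / ennreal p
      = ennreal (exp (c / t) * ?g / p)"
    using g \<open>0 < p\<close> by (simp add: divide_ennreal)
  moreover have "0 < exp (c / t) * ?g / p" using g \<open>0 < p\<close> by simp
  moreover have "ln (exp (c / t) * ?g / p) = c / t + ln (?g / p)"
    using g \<open>0 < p\<close> by (simp add: ln_mult ln_div)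
  ultimately show ?thesis
    using g \<open>0 < t\<close> \<open>0 < p\<close> by (simp add: Binf_def eln_def distrib_left)
qed

lemma Binf_eq_PInf:
  fixes X :: "'a \<Rightarrow> real"
  assumes [measurable]: "X \<in> borel_measurable M"
    and nint: "\<not> integrable M (\<lambda>\<omega>. exp ((X \<omega> - c) / t))" and "0 < t" "0 < p"
  shows "Binf M X p t = \<infinity>"
proof -
  have "\<not> integrable M (\<lambda>\<omega>. exp (X \<omega> / t))"
  proof
    assume "integrable M (\<lambda>\<omega>. exp (X \<omega> / t))"
    then have "integrable M (\<lambda>\<omega>. exp (X \<omega> / t) / exp (c / t))" by simp
    with nint show False by (simp add: diff_divide_distrib exp_diff)
  qed
  then have "(\<integral>\<^sup>+ \<omega>. ennreal (exp (X \<omega> / t)) \<partial>M) = \<infinity>"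
    by (simp add: integrable_iff_bounded not_less top_unique)
  then show ?thesis
    using \<open>0 < t\<close> \<open>0 < p\<close> by (simp add: Binf_def eln_def ennreal_divide_eq_top_iff ennreal_top_divide)
qed

text \<open>Shifting by the level \<open>c\<close> itself turns the comparison into one of
  \<open>ln (g / p)\<close> with 0, so logarithm and factor \<open>t\<close> disappear. The
  nonnegative integral includes the case of infinite expectation and is ready for Markov and
  Fatou.\<close>

lemma Binf_iff:
  fixes X :: "'a \<Rightarrow> real"
  assumes [measurable]: "X \<in> borel_measurable M" and "0 < t" "0 < p"
  shows Binf_le_iff: "Binf M X p t \<le> ereal c
      \<longleftrightarrow> (\<integral>\<^sup>+ \<omega>. ennreal (exp ((X \<omega> - c) / t)) \<partial>M) \<le> ennreal p"
    and Binf_less_iff: "Binf M X p t < ereal c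
      \<longleftrightarrow> (\<integral>\<^sup>+ \<omega>. ennreal (exp ((X \<omega> - c) / t)) \<partial>M) < ennreal p"
proof -
  let ?N = "\<integral>\<^sup>+ \<omega>. ennreal (exp ((X \<omega> - c) / t)) \<partial>M"
  have "(Binf M X p t \<le> ereal c \<longleftrightarrow> ?N \<le> ennreal p) \<and> (Binf M X p t < ereal c \<longleftrightarrow> ?N < ennreal p)"
  proof (cases "integrable M (\<lambda>\<omega>. exp ((X \<omega> - c) / t))")
    case True
    let ?g = "\<integral>\<omega>. exp ((X \<omega> - c) / t) \<partial>M"
    have N: "?N = ennreal ?g" using True by (intro nn_integral_eq_integral) auto
    have g: "0 < ?g" using integral_exp_pos[OF True] .
    show ?thesis
      using g \<open>0 < t\<close> \<open>0 < p\<close>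
      by (simp add: N Binf_eq[OF True] ennreal_less_iff mult_le_0_iff mult_less_0_iff ln_div)
  next
    case False
    then have "?N = \<infinity>" by (simp add: integrable_iff_bounded not_less top_unique)
    then show ?thesis using Binf_eq_PInf[OF assms(1) False assms(2,3)] by (simp add: top_unique)
  qed
  then show "Binf M X p t \<le> ereal c \<longleftrightarrow> ?N \<le> ennreal p" "Binf M X p t < ereal c \<longleftrightarrow> ?N < ennreal p"
    by auto
qed

lemma Pfun_less_iff_Binf:
  fixes X :: "'a \<Rightarrow> real"
  assumes X: "X \<in> borel_measurable M" and p: "0 < p"
  shows "Pfun M \<infinity> X x < ennreal p \<longleftrightarrow> (\<exists>t\<in>{0<..}. Binf M X p t < ereal x)"
proof -
  have *: "(\<integral>\<^sup>+ \<omega>. ennreal (hfun \<infinity> (l * (X \<omega> - x))) \<partial>M) < ennreal p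
      \<longleftrightarrow> Binf M X p (1 / l) < ereal x" if "0 < l" for l
    using Binf_less_iff[OF X _ p, of "1 / l" x] that by (simp add: hfun_def mult.commute)
  show ?thesis
  proof
    assume "Pfun M \<infinity> X x < ennreal p"
    then obtain l where "0 < l" "(\<integral>\<^sup>+ \<omega>. ennreal (hfun \<infinity> (l * (X \<omega> - x))) \<partial>M) < ennreal p"
      by (auto simp: Pfun_def INF_less_iff)
    then show "\<exists>t\<in>{0<..}. Binf M X p t < ereal x"
      using * by (intro bexI[of _ "1 / l"]) auto
  next
    assume "\<exists>t\<in>{0<..}. Binf M X p t < ereal x"
    then obtain t where "0 < t" "Binf M X p t < ereal x" by auto
    then show "Pfun M \<infinity> X x < ennreal p"
      using *[of "1 / t"] by (auto simp: Pfun_def INF_less_iff intro!: bexI[of _ "1 / t"])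
  qed
qed

lemma Qfun_eq_INF_Binf:
  fixes X :: "'a \<Rightarrow> real"
  assumes "X \<in> borel_measurable M" "0 < p"
  shows "Qfun M \<infinity> X p = (INF t\<in>{0<..}. Binf M X p t)"
  by (rule Qfun_eq_INF) (rule Pfun_less_iff_Binf[OF assms])

lemma Binf_ge_quantile:
  fixes X :: "'a \<Rightarrow> real"
  assumes X[measurable]: "X \<in> borel_measurable M" and "0 < t" "0 < p" "0 < q"
    and q: "q \<le> prob {\<omega> \<in> space M. x \<le> X \<omega>}"
  shows "ereal (x + t * ln (q / p)) \<le> Binf M X p t"
proof -
  let ?A = "{\<omega> \<in> space M. x \<le> X \<omega>}"
  \<comment> \<open>The level is chosen so that the exponential equals \<open>p / q\<close> at
    \<open>X \<omega> = x\<close>; as the event has probability at least \<open>q\<close>, the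
    expectation is then at least \<open>p\<close>.\<close>
  define c where "c = x + t * ln (q / p)"
  have e: "exp ((x - c) / t) = p / q"
    using assms by (simp add: c_def exp_minus)
  have "ennreal p = ennreal (p / q) * ennreal q"
    using assms by (simp flip: ennreal_mult'')
  also have "\<dots> \<le> ennreal (p / q) * emeasure M ?A"
    using q by (intro mult_left_mono) (auto simp: emeasure_eq_measure)
  also have "\<dots> = (\<integral>\<^sup>+ \<omega>. ennreal (p / q) * indicator ?A \<omega> \<partial>M)"
    by (subst nn_integral_cmult_indicator) auto
  also have "\<dots> \<le> (\<integral>\<^sup>+ \<omega>. ennreal (exp ((X \<omega> - c) / t)) \<partial>M)"
  proof (rule nn_integral_mono)
    fix \<omega>
    show "ennreal (p / q) * indicator ?A \<omega> \<le> ennreal (exp ((X \<omega> - c) / t))"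
      unfolding e[symmetric] using \<open>0 < t\<close>
      by (auto split: split_indicator intro!: ennreal_leI divide_right_mono)
  qed
  finally have "\<not> Binf M X p t < ereal c"
    using Binf_less_iff[OF X \<open>0 < t\<close> \<open>0 < p\<close>, of c] by (simp add: not_less)
  then show ?thesis by (simp add: c_def not_less)
qed

text \<open>Lower semicontinuity, by Fatou's lemma; \<^term>\<open>Binf M X p\<close> may jump to \<open>\<infinity>\<close>.\<close>

lemma Binf_le_limit:
  fixes X :: "'a \<Rightarrow> real" and t c :: "nat \<Rightarrow> real"
  assumes X[measurable]: "X \<in> borel_measurable M" and "0 < p" "0 < s"
    and t: "t \<longlonglongrightarrow> s" "\<And>n. 0 < t n" and c: "c \<longlonglongrightarrow> m"
    and le: "\<And>n. Binf M X p (t n) \<le> ereal (c n)"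
  shows "Binf M X p s \<le> ereal m"
proof -
  have "(\<integral>\<^sup>+ \<omega>. ennreal (exp ((X \<omega> - m) / s)) \<partial>M)
      = (\<integral>\<^sup>+ \<omega>. liminf (\<lambda>n. ennreal (exp ((X \<omega> - c n) / t n))) \<partial>M)"
  proof (rule nn_integral_cong)
    fix \<omega>
    have "(\<lambda>n. ennreal (exp ((X \<omega> - c n) / t n))) \<longlonglongrightarrow> ennreal (exp ((X \<omega> - m) / s))"
      using t c \<open>0 < s\<close> by (intro tendsto_intros) auto
    then show "ennreal (exp ((X \<omega> - m) / s)) = liminf (\<lambda>n. ennreal (exp ((X \<omega> - c n) / t n)))"
      by (intro lim_imp_Liminf[symmetric]) auto
  qed
  also have "\<dots> \<le> liminf (\<lambda>n. \<integral>\<^sup>+ \<omega>. ennreal (exp ((X \<omega> - c n) / t n)) \<partial>M)"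
    by (rule nn_integral_liminf) auto
  also have "\<dots> \<le> liminf (\<lambda>n. ennreal p)"
    using le Binf_le_iff[OF X t(2) \<open>0 < p\<close>] by (intro Liminf_mono always_eventually) auto
  finally show ?thesis
    using Binf_le_iff[OF X \<open>0 < s\<close> \<open>0 < p\<close>] by (simp add: Liminf_const)
qed

text \<open>The Markov bound is used twice on the sublevel set at \<open>C\<close>. A point
  \<open>y\<close> with tail above \<open>p\<close> bounds \<open>t\<close> from above; the point
  \<open>x > C\<close>, whose tail need only be positive, keeps \<open>t\<close> away from 0. A
  minimizing sequence then has a positive limit point, where lower semicontinuity applies.\<close>

lemma Binf_attained:
  fixes X :: "'a \<Rightarrow> real"
  assumes X: "X \<in> borel_measurable M" and p: "0 < p" "p < 1"
    and C: "C < x" "0 < prob {\<omega> \<in> space M. x \<le> X \<omega>}" "0 < r" "Binf M X p r < ereal C"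
  shows "\<exists>s>0. \<forall>t>0. Binf M X p s \<le> Binf M X p t"
proof -
  let ?B = "Binf M X p"
  define m where "m = (INF t\<in>{0<..}. ?B t)"
  obtain q where q: "p < q" "q < 1" using \<open>p < 1\<close> dense by blast
  obtain y where y: "q < prob {\<omega> \<in> space M. y \<le> X \<omega>}"
    using prob_ge_large[OF X \<open>q < 1\<close>] by blast
  have lnq: "0 < ln (q / p)" using q p by simp
  have lower: "ereal (y + t * ln (q / p)) \<le> ?B t" if "0 < t" for t
    using Binf_ge_quantile[OF X that p(1) _ less_imp_le[OF y]] q p by simp
  have "ereal y \<le> m" unfolding m_def
  proof (rule INF_greatest)
    fix t :: real assume "t \<in> {0<..}"
    then have "ereal y \<le> ereal (y + t * ln (q / p))" using lnq by simp
    also have "\<dots> \<le> ?B t" using \<open>t \<in> {0<..}\<close> by (intro lower) simp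
    finally show "ereal y \<le> ?B t" .
  qed
  moreover have m_less: "m < ereal C"
    unfolding m_def using C by (auto simp: INF_less_iff)
  ultimately obtain \<mu> where \<mu>: "m = ereal \<mu>" by (cases m) auto
  \<comment> \<open>The tail at \<open>x\<close> may be smaller than \<open>p\<close>, making
    \<open>k\<close> negative; \<open>\<bar>k\<bar> + 1\<close> is a positive bound for
    \<open>- k\<close>.\<close>
  define k where "k = ln (prob {\<omega> \<in> space M. x \<le> X \<omega>} / p)"
  define a where "a = (x - C) / (\<bar>k\<bar> + 1)"
  define b where "b = (C - y) / ln (q / p)"
  have "0 < a" using C by (simp add: a_def)
  have ab: "t \<in> {a..b}" if "0 < t" "?B t < ereal C" for t
  proof -
    have "ereal (x + t * k) < ereal C"
      unfolding k_def using Binf_ge_quantile[OF X that(1) p(1) C(2) order_refl] that(2)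
      by (rule le_less_trans)
    then have "x - C \<le> t * (- k)" by simp
    also have "\<dots> \<le> t * (\<bar>k\<bar> + 1)" using \<open>0 < t\<close> by (intro mult_left_mono) auto
    finally have "a \<le> t" by (simp add: a_def field_simps)
    moreover have "ereal (y + t * ln (q / p)) < ereal C"
      using lower[OF that(1)] that(2) by (rule le_less_trans)
    then have "t \<le> b" using lnq by (simp add: b_def field_simps)
    ultimately show ?thesis by simp
  qed
  \<comment> \<open>The minimum with \<open>C\<close> keeps the whole minimizing sequence in the
    sublevel set, hence in \<open>{a..b}\<close>.\<close>
  have "\<exists>t>0. ?B t < ereal (min C (\<mu> + 1 / real (Suc n)))" for n
  proof -
    have "m < ereal (min C (\<mu> + 1 / real (Suc n)))"
      using m_less \<mu> by simp
    then show ?thesis unfolding m_def INF_less_iff by (meson greaterThan_iff)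
  qed
  then obtain t where t: "\<And>n. 0 < t n" "\<And>n. ?B (t n) < ereal (min C (\<mu> + 1 / real (Suc n)))"
    by metis
  have "t n \<in> {a..b}" for n
  proof -
    have "?B (t n) < ereal C" using t(2)[of n] by (rule less_le_trans) simp
    then show ?thesis using ab t(1) by blast
  qed
  then obtain s f where s: "s \<in> {a..b}" "strict_mono f" "(t \<circ> f) \<longlonglongrightarrow> s"
    using compact_Icc[of a b] unfolding compact_def by (metis (no_types, lifting))
  have "(\<lambda>n. \<mu> + 1 / real (Suc n)) \<longlonglongrightarrow> \<mu> + 0"
    by (intro tendsto_add tendsto_const LIMSEQ_Suc[OF lim_1_over_n])
  then have c: "((\<lambda>n. \<mu> + 1 / real (Suc n)) \<circ> f) \<longlonglongrightarrow> \<mu>"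
    using LIMSEQ_subseq_LIMSEQ[OF _ s(2)] by fastforce
  have "0 < s" using s(1) \<open>0 < a\<close> by simp
  have "?B s \<le> ereal \<mu>"
  proof (rule Binf_le_limit[OF X p(1) \<open>0 < s\<close> s(3) _ c])
    show "?B ((t \<circ> f) n) \<le> ereal (((\<lambda>n. \<mu> + 1 / real (Suc n)) \<circ> f) n)" for n
    proof -
      have "?B (t (f n)) \<le> ereal (min C (\<mu> + 1 / real (Suc (f n))))"
        using t(2) by (rule less_imp_le)
      also have "\<dots> \<le> ereal (\<mu> + 1 / real (Suc (f n)))" by simp
      finally show ?thesis by simp
    qed
  qed (use t in auto)
  then have "\<forall>t>0. ?B s \<le> ?B t"
    unfolding \<mu>[symmetric] m_def by (auto simp: le_INF_iff)
  with \<open>0 < s\<close> show ?thesis by blast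
qed

section \<open>The right endpoint of the support\<close>

text \<open>The complement of the support is a union of open null sets. By Lindelof countably many
  of them suffice, so \<open>X\<close> lies in its support almost surely.\<close>

lemma AE_le_xstar:
  fixes X :: "'a \<Rightarrow> real"
  assumes [measurable]: "X \<in> borel_measurable M"
  shows "AE \<omega> in M. ereal (X \<omega>) \<le> xstar M X"
proof -
  define F where "F = {U. open U \<and> measure (distr M borel X) U = 0}"
  obtain F' where F': "F' \<subseteq> F" "countable F'" "\<Union>F' = \<Union>F"
    using Lindelof[of F] by (auto simp: F_def)
  have "AE \<omega> in M. \<forall>U\<in>F'. X \<omega> \<notin> U"
  proof (rule AE_ball_countable'[OF _ F'(2)])
    fix U assume "U \<in> F'"
    then have U: "open U" "measure (distr M borel X) U = 0" using F'(1) by (auto simp: F_def)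
    then have "prob (X -` U \<inter> space M) = 0" by (simp add: measure_distr)
    then have "X -` U \<inter> space M \<in> null_sets M"
      using U by (intro null_setsI) (auto simp: emeasure_eq_measure)
    then show "AE \<omega> in M. X \<omega> \<notin> U" by (rule AE_I') auto
  qed
  then show ?thesis
  proof eventually_elim
    fix \<omega> assume "\<forall>U\<in>F'. X \<omega> \<notin> U"
    then have "X \<omega> \<notin> \<Union>F" using F'(3) by blast
    then have "X \<omega> \<in> supp M X"
      unfolding supp_def F_def by (auto simp: less_le)
    then show "ereal (X \<omega>) \<le> xstar M X" unfolding xstar_def by (rule SUP_upper)
  qed
qed

lemma xstar_not_MInf:
  fixes X :: "'a \<Rightarrow> real"
  assumes "X \<in> borel_measurable M"
  shows "xstar M X \<noteq> -\<infinity>"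
  using AE_le_xstar[OF assms] by auto

text \<open>Some support point lies beyond \<open>x\<close>, and the open ray above \<open>x\<close>
  is a neighbourhood of it. This provides the positive tail required by
  \<open>Binf_attained\<close>.\<close>

lemma prob_ge_pos:
  fixes X :: "'a \<Rightarrow> real"
  assumes [measurable]: "X \<in> borel_measurable M" and x: "ereal x < xstar M X"
  shows "0 < prob {\<omega> \<in> space M. x \<le> X \<omega>}"
proof -
  obtain y where "y \<in> supp M X" "x < y"
    using x by (auto simp: xstar_def less_SUP_iff)
  then have "0 < measure (distr M borel X) {x<..}"
    unfolding supp_def by (auto intro: open_greaterThan)
  also have "\<dots> = prob (X -` {x<..} \<inter> space M)" by (simp add: measure_distr)
  also have "\<dots> \<le> prob {\<omega> \<in> space M. x \<le> X \<omega>}"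
    by (intro finite_measure_mono) auto
  finally show ?thesis .
qed

section \<open>Index infinity: the attained case\<close>

text \<open>Along \<open>t = 1 / (n + 1)\<close> the exponential of \<open>(X - z) / t\<close> is
  bounded by 1 and tends to the indicator of \<open>X = z\<close>. Its expectation therefore tends
  to \<open>pstar M X\<close> and eventually drops below \<open>p\<close>, which by
  \<open>Binf_less_iff\<close> means a value below \<open>z\<close>.\<close>

lemma ex_Binf_less_xstar:
  fixes X :: "'a \<Rightarrow> real"
  assumes X[measurable]: "X \<in> borel_measurable M" and "0 < p"
    and z: "xstar M X = ereal z" and "pstar M X < p"
  shows "\<exists>t>0. Binf M X p t < ereal z"
proof -
  have AE: "AE \<omega> in M. X \<omega> \<le> z" using AE_le_xstar[OF X] by (simp add: z)
  have bound: "norm (exp ((X \<omega> - z) / (1 / real (Suc n)))) \<le> 1" if "X \<omega> \<le> z" for \<omega> n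
    using that by (simp add: mult_nonpos_nonneg)
  have int: "integrable M (\<lambda>\<omega>. exp ((X \<omega> - z) / (1 / real (Suc n))))" for n
  proof (rule integrable_const_bound[where B = 1])
    show "AE \<omega> in M. norm (exp ((X \<omega> - z) / (1 / real (Suc n)))) \<le> 1"
      using AE by eventually_elim (rule bound)
  qed auto
  have "(\<lambda>n. \<integral>\<omega>. exp ((X \<omega> - z) / (1 / real (Suc n))) \<partial>M)
      \<longlonglongrightarrow> (\<integral>\<omega>. indicator {\<omega> \<in> space M. X \<omega> = z} \<omega> \<partial>M)"
  proof (rule integral_dominated_convergence[where w = "\<lambda>_. 1"])
    show "AE \<omega> in M. norm (exp ((X \<omega> - z) / (1 / real (Suc n)))) \<le> 1" for n
      using AE by eventually_elim (rule bound)
    show "AE \<omega> in M. (\<lambda>n. exp ((X \<omega> - z) / (1 / real (Suc n))))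
        \<longlonglongrightarrow> indicator {\<omega> \<in> space M. X \<omega> = z} \<omega>"
      using AE AE_space
    proof eventually_elim
      fix \<omega> assume \<omega>: "X \<omega> \<le> z" "\<omega> \<in> space M"
      show "(\<lambda>n. exp ((X \<omega> - z) / (1 / real (Suc n)))) \<longlonglongrightarrow> indicator {\<omega> \<in> space M. X \<omega> = z} \<omega>"
      proof (cases "X \<omega> = z")
        case False
        then have "norm (exp (X \<omega> - z)) < 1" using \<omega> by simp
        \<comment> \<open>Dividing by \<open>1 / (n + 1)\<close> makes this a geometric sequence
          with ratio \<open>exp (X \<omega> - z) < 1\<close>.\<close>
        then have "(\<lambda>n. exp (X \<omega> - z) ^ Suc n) \<longlonglongrightarrow> 0"
          by (intro LIMSEQ_Suc LIMSEQ_power_zero)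
        also have "(\<lambda>n. exp (X \<omega> - z) ^ Suc n) = (\<lambda>n. exp ((X \<omega> - z) / (1 / real (Suc n))))"
          by (simp only: exp_of_nat_mult[symmetric]) (simp add: mult.commute)
        finally show ?thesis using False by simp
      qed (use \<omega> in simp)
    qed
  qed auto
  also have "(\<integral>\<omega>. indicator {\<omega> \<in> space M. X \<omega> = z} \<omega> \<partial>M) = pstar M X"
    by (simp add: pstar_def z)
  finally have "eventually (\<lambda>n. (\<integral>\<omega>. exp ((X \<omega> - z) / (1 / real (Suc n))) \<partial>M) < p) sequentially"
    using \<open>pstar M X < p\<close> by (intro order_tendstoD)
  then obtain n where n: "(\<integral>\<omega>. exp ((X \<omega> - z) / (1 / real (Suc n))) \<partial>M) < p"
    by (auto simp: eventually_sequentially)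
  have "Binf M X p (1 / real (Suc n)) < ereal z"
  proof (subst Binf_less_iff[OF X _ \<open>0 < p\<close>])
    show "(\<integral>\<^sup>+ \<omega>. ennreal (exp ((X \<omega> - z) / (1 / real (Suc n)))) \<partial>M) < ennreal p"
      using n \<open>0 < p\<close> by (subst nn_integral_eq_integral[OF int]) (auto simp: ennreal_lessI)
  qed simp
  then show ?thesis by (intro exI[of _ "1 / real (Suc n)"]) simp
qed

text \<open>It remains to find a level \<open>C\<close> below the endpoint that exceeds some value
  of \<open>B\<close>. For a finite endpoint this is the preceding lemma; for an infinite one any
  finite value of \<open>B\<close> will do, and the exponential moment supplies it.\<close>

lemma Binf_attained':
  fixes X :: "'a \<Rightarrow> real"
  assumes X: "X \<in> XX M \<infinity>" and p: "0 < p" "p < 1"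
    and np: "\<not> (xstar M X < \<infinity> \<and> p \<le> pstar M X)"
  shows "\<exists>s>0. \<forall>t>0. Binf M X p s \<le> Binf M X p t"
proof -
  have Xm: "X \<in> borel_measurable M" using X by (simp add: XX_def)
  obtain C x r where "C < x" "ereal x < xstar M X" "0 < r" "Binf M X p r < ereal C"
  proof (cases "xstar M X")
    case (real z)
    then obtain r where r: "0 < r" "Binf M X p r < ereal z"
      using ex_Binf_less_xstar[OF Xm p(1) real] np by auto
    obtain C where C: "Binf M X p r < ereal C" "C < z"
      using ereal_dense2[OF r(2)] by auto
    obtain x where "C < x" "x < z" using C(2) dense by blast
    with r C that real show ?thesis by auto
  next
    case PInf
    obtain l where l: "0 < l" "integrable M (\<lambda>\<omega>. exp (l * X \<omega>))"
      using X by (auto simp: XX_def)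
    then have "Binf M X p (1 / l) < \<infinity>"
      using Binf_eq[of X 0 "1 / l" p] p by (simp add: mult.commute)
    then obtain C where "Binf M X p (1 / l) < ereal C"
      using ereal_dense2 by blast
    with that[of C "C + 1" "1 / l"] PInf l show ?thesis by simp
  next
    case MInf
    then show ?thesis using xstar_not_MInf[OF Xm] by simp
  qed
  then show ?thesis using Binf_attained[OF Xm p] prob_ge_pos[OF Xm] by blast
qed

section \<open>Index infinity: the case without a minimizer\<close>

text \<open>Everything follows from \<open>B t = z + t * ln (g t / p)\<close> with \<open>g\<close>
  increasing and \<open>p < g t \<le> 1\<close>: the logarithm is positive and bounded by
  \<open>ln (1 / p)\<close>, which also sandwiches the limit at 0.\<close>

lemma
  fixes X :: "'a \<Rightarrow> real"
  assumes X[measurable]: "X \<in> borel_measurable M" and p: "0 < p" "p < 1"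
    and z: "xstar M X = ereal z" and pz: "p \<le> pstar M X"
  shows Binf_strict_mono: "strict_mono_on {0<..} (Binf M X p)"
    and Binf_greater_xstar: "0 < t \<Longrightarrow> xstar M X < Binf M X p t"
    and Binf_tendsto_xstar: "(Binf M X p \<longlongrightarrow> xstar M X) (at_right 0)"
proof -
  define g where "g t = (\<integral>\<omega>. exp ((X \<omega> - z) / t) \<partial>M)" for t
  let ?A = "{\<omega> \<in> space M. X \<omega> = z}"
  have AE: "AE \<omega> in M. X \<omega> \<le> z" using AE_le_xstar[OF X] by (simp add: z)
  have pA: "p \<le> prob ?A" using pz by (simp add: pstar_def z)
  have AE1: "AE \<omega> in M. exp ((X \<omega> - z) / t) \<le> 1" if "0 < t" for t
    using AE by eventually_elim (use that in \<open>simp add: divide_nonpos_pos\<close>)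
  have int: "integrable M (\<lambda>\<omega>. exp ((X \<omega> - z) / t))" if "0 < t" for t
    by (rule integrable_const_bound[where B = 1]) (use AE1[OF that] in auto)
  have B: "Binf M X p t = ereal (z + t * ln (g t / p))" if "0 < t" for t
    unfolding g_def by (rule Binf_eq[OF int[OF that] that p(1)])
  have g1: "g t \<le> 1" if "0 < t" for t
    unfolding g_def using integral_mono_AE[OF int[OF that] _ AE1[OF that]] by (simp add: prob_space)
  have gp: "p < g t" if "0 < t" for t
  proof -
    have le: "indicator ?A \<omega> \<le> exp ((X \<omega> - z) / t)" for \<omega>
      by (auto split: split_indicator)
    have iA: "integrable M (indicator ?A :: 'a \<Rightarrow> real)"
      by (intro integrable_real_indicator) (auto simp: emeasure_eq_measure)
    have "prob ?A \<le> g t"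
      unfolding g_def using integral_mono[OF iA int[OF that] le] by simp
    \<comment> \<open>Strictness matters when the atom has mass exactly \<open>p\<close>. Equality
      would make the exponential agree almost surely with the indicator of \<open>?A\<close>; being
      positive, it forces \<open>X = z\<close> almost surely, so the atom has mass 1, against
      \<open>p < 1\<close>.\<close>
    moreover have "p \<noteq> g t"
    proof
      assume "p = g t"
      with \<open>prob ?A \<le> g t\<close> pA have eq: "prob ?A = g t" by simp
      have "(\<integral>\<omega>. exp ((X \<omega> - z) / t) - indicator ?A \<omega> \<partial>M) = 0"
        using eq iA int[OF that] by (simp add: g_def)
      then have "AE \<omega> in M. exp ((X \<omega> - z) / t) - indicator ?A \<omega> = 0"
        using iA int[OF that] le by (subst (asm) integral_nonneg_eq_0_iff_AE) auto
      then have "AE \<omega> in M. X \<omega> = z"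
        by eventually_elim (auto split: split_indicator_asm)
      then have "prob ?A = 1" by (intro prob_Collect_eq_1[THEN iffD2]) auto
      with eq \<open>p = g t\<close> p show False by simp
    qed
    ultimately show ?thesis using pA by simp
  qed
  have lnpos: "0 < ln (g t / p)" if "0 < t" for t
    using gp[OF that] p by simp
  show "xstar M X < Binf M X p t" if "0 < t" for t
    using lnpos[OF that] that by (simp add: B z)
  show "strict_mono_on {0<..} (Binf M X p)"
  proof (rule strict_mono_onI)
    fix s t :: real
    assume st: "s \<in> {0<..}" "t \<in> {0<..}" "s < t"
    have "g s \<le> g t"
      unfolding g_def
    proof (rule integral_mono_AE)
      show "AE \<omega> in M. exp ((X \<omega> - z) / s) \<le> exp ((X \<omega> - z) / t)"
        using AE by eventually_elim (use st in \<open>auto intro!: divide_left_mono_neg[of _ _ "_ - z"]\<close>)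
    qed (use int st in auto)
    then have "ln (g s / p) \<le> ln (g t / p)"
      using gp[of s] st p by (simp add: divide_right_mono)
    then have "s * ln (g s / p) \<le> s * ln (g t / p)" using st by simp
    \<comment> \<open>The strict increase comes from the factor \<open>t\<close>, since
      \<open>g\<close> is constant when \<open>X = z\<close> almost surely.\<close>
    also have "\<dots> < t * ln (g t / p)" using st lnpos[of t] by simp
    finally show "Binf M X p s < Binf M X p t" using st by (simp add: B)
  qed
  have "((\<lambda>t. z + t * ln (g t / p)) \<longlongrightarrow> z) (at_right 0)"
  proof (rule tendsto_sandwich)
    show "eventually (\<lambda>t. z \<le> z + t * ln (g t / p)) (at_right 0)"
      using lnpos by (auto simp: eventually_at_right_field intro!: exI[of _ 1] less_imp_le)
    show "eventually (\<lambda>t. z + t * ln (g t / p) \<le> z + t * ln (1 / p)) (at_right 0)"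
    proof -
      have "t * ln (g t / p) \<le> t * ln (1 / p)" if "0 < t" for t
        using that g1[OF that] gp[OF that] p by (auto simp: divide_right_mono)
      then show ?thesis by (auto simp: eventually_at_right_field intro!: exI[of _ 1])
    qed
    have "((\<lambda>t. z + t * ln (1 / p)) \<longlongrightarrow> z + 0 * ln (1 / p)) (at_right 0)"
      by (intro tendsto_intros)
    then show "((\<lambda>t. z + t * ln (1 / p)) \<longlongrightarrow> z) (at_right 0)" by simp
  qed auto
  then have "((\<lambda>t. ereal (z + t * ln (g t / p))) \<longlongrightarrow> xstar M X) (at_right 0)"
    by (simp add: z)
  then show "(Binf M X p \<longlongrightarrow> xstar M X) (at_right 0)"
    by (rule Lim_transform_eventually)
      (auto simp: eventually_at_right_field B intro!: exI[of _ 1])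
qed

end

section \<open>Assembly of both parts of the theorem\<close>

theorem proposition3p3:
  fixes M :: "'a measure" and p :: real
  assumes "prob_space M" and "0 < p" and "p < 1"
  shows
    "(\<forall>\<alpha>::real. \<forall>X. 0 < \<alpha> \<longrightarrow> X \<in> XX M (ennreal \<alpha>) \<longrightarrow>
        (\<exists>topt. \<forall>t. Bfin M \<alpha> X p topt \<le> Bfin M \<alpha> X p t) \<and>
        (\<forall>topt. (\<forall>t. Bfin M \<alpha> X p topt \<le> Bfin M \<alpha> X p t) \<longrightarrow>
           Qfun M (ennreal \<alpha>) X p = ereal (Bfin M \<alpha> X p topt) \<and>
           (\<forall>s q. p < q \<longrightarrow> q < 1 \<longrightarrow>
              (let c = ereal ((q / p) powr (1 / \<alpha>));
                   tmax = ereal (Bfin M \<alpha> X p s);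
                   t0min = Qfun M 0 X q;
                   t1min = (c * t0min - tmax) / (c - 1);
                   tmin = min t0min t1min
               in \<bar>t0min\<bar> \<noteq> \<infinity> \<and> ereal topt \<in> {tmin..tmax})))) \<and>
     (\<forall>X. X \<in> XX M \<infinity> \<longrightarrow>
        (\<not> (xstar M X < \<infinity> \<and> p \<le> pstar M X) \<longrightarrow>
           (\<exists>topt>0. (\<forall>t>0. Binf M X p topt \<le> Binf M X p t) \<and>
                     Qfun M \<infinity> X p = Binf M X p topt)) \<and>
        (xstar M X < \<infinity> \<and> p \<le> pstar M X \<longrightarrow>
           strict_mono_on {0<..} (Binf M X p) \<and>
           \<not> (\<exists>topt>0. \<forall>t>0. Binf M X p topt \<le> Binf M X p t) \<and>
           Qfun M \<infinity> X p = (INF t\<in>{0<..}. Binf M X p t) \<and>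
           (INF t\<in>{0<..}. Binf M X p t) = xstar M X \<and>
           (Binf M X p \<longlongrightarrow> xstar M X) (at_right 0)))"
proof -
  interpret prob_space M by fact
  note p = \<open>0 < p\<close> \<open>p < 1\<close>
  show ?thesis
  proof (intro conjI allI impI)
    fix \<alpha> :: real and X
    assume \<alpha>: "0 < \<alpha>" and "X \<in> XX M (ennreal \<alpha>)"
    then have X: "X \<in> borel_measurable M" "integrable M (\<lambda>\<omega>. max 0 (X \<omega>) powr \<alpha>)"
      by (auto simp: XX_def)
    show "\<exists>topt. \<forall>t. Bfin M \<alpha> X p topt \<le> Bfin M \<alpha> X p t"
      by (rule Bfin_attained[OF X \<alpha> p])
    fix topt
    assume opt: "\<forall>t. Bfin M \<alpha> X p topt \<le> Bfin M \<alpha> X p t"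
    show "Qfun M (ennreal \<alpha>) X p = ereal (Bfin M \<alpha> X p topt)"
      unfolding Qfun_eq_INF_Bfin[OF X \<alpha> p(1)] using opt
      by (intro antisym INF_greatest INF_lower) auto
    fix s q
    assume q: "p < q" "q < 1"
    then obtain z where z: "Qfun M 0 X q = ereal z" "q \<le> prob {\<omega> \<in> space M. z \<le> X \<omega>}"
      using Qfun_0_quantile[OF X(1), of q] p by auto
    define c where "c = (q / p) powr (1 / \<alpha>)"
    define b where "b = Bfin M \<alpha> X p s"
    have "Bfin M \<alpha> X p topt \<le> b" using opt by (simp add: b_def)
    \<comment> \<open>A minimizer lies in the sublevel set at level \<open>B s\<close> for every
      \<open>s\<close>; with \<open>z\<close> the quantile of index 0 at \<open>q\<close>, the lower
      bound is exactly \<open>tmin\<close>.\<close>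
    note ge = Bfin_sublevel_ge[OF X \<alpha> p(1) q(1) z(2) this, folded c_def]
    have "topt \<le> b"
      using Bfin_ge[OF p(1) \<alpha>, of topt M X] \<open>Bfin M \<alpha> X p topt \<le> b\<close> by simp
    \<comment> \<open>Since \<open>c > 1\<close>, the divisor is a nonzero real, so the
      extended-real expression agrees with the real one.\<close>
    moreover have "(ereal c * ereal z - ereal b) / (ereal c - 1) = ereal ((c * z - b) / (c - 1))"
      using ge(1) by (simp add: one_ereal_def)
    ultimately show "let c = ereal ((q / p) powr (1 / \<alpha>));
                   tmax = ereal (Bfin M \<alpha> X p s);
                   t0min = Qfun M 0 X q;
                   t1min = (c * t0min - tmax) / (c - 1);
                   tmin = min t0min t1min
               in \<bar>t0min\<bar> \<noteq> \<infinity> \<and> ereal topt \<in> {tmin..tmax}"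
      using ge(2) unfolding Let_def z(1) c_def[symmetric] b_def[symmetric] by (simp add: min_le_iff_disj)
  next
    fix X
    assume X: "X \<in> XX M \<infinity>" and np: "\<not> (xstar M X < \<infinity> \<and> p \<le> pstar M X)"
    then have Xm: "X \<in> borel_measurable M" by (simp add: XX_def)
    obtain s where s: "0 < s" "\<forall>t>0. Binf M X p s \<le> Binf M X p t"
      using Binf_attained'[OF X p np] by blast
    have "Qfun M \<infinity> X p = Binf M X p s"
      unfolding Qfun_eq_INF_Binf[OF Xm p(1)] using s
      by (intro antisym INF_greatest INF_lower) auto
    with s show "\<exists>topt>0. (\<forall>t>0. Binf M X p topt \<le> Binf M X p t) \<and> Qfun M \<infinity> X p = Binf M X p topt"
      by blast
  next
    fix X
    assume X: "X \<in> XX M \<infinity>" and star: "xstar M X < \<infinity> \<and> p \<le> pstar M X"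
    then have Xm: "X \<in> borel_measurable M" by (simp add: XX_def)
    obtain z where z: "xstar M X = ereal z"
      using star xstar_not_MInf[OF Xm] by (cases "xstar M X") auto
    note facts = Xm p z conjunct2[OF star]
    show mono: "strict_mono_on {0<..} (Binf M X p)"
      by (rule Binf_strict_mono[OF facts])
    show lim: "(Binf M X p \<longlongrightarrow> xstar M X) (at_right 0)"
      by (rule Binf_tendsto_xstar[OF facts])
    show "\<not> (\<exists>topt>0. \<forall>t>0. Binf M X p topt \<le> Binf M X p t)"
    proof
      assume "\<exists>topt>0. \<forall>t>0. Binf M X p topt \<le> Binf M X p t"
      then obtain s where s: "0 < s" "\<forall>t>0. Binf M X p s \<le> Binf M X p t" by blast
      then have "Binf M X p (s / 2) < Binf M X p s"
        by (intro strict_mono_onD[OF mono]) auto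
      moreover have "Binf M X p s \<le> Binf M X p (s / 2)" using s by simp
      ultimately show False by simp
    qed
    show "Qfun M \<infinity> X p = (INF t\<in>{0<..}. Binf M X p t)"
      by (rule Qfun_eq_INF_Binf[OF Xm p(1)])
    show "(INF t\<in>{0<..}. Binf M X p t) = xstar M X"
    proof (rule antisym)
      show "(INF t\<in>{0<..}. Binf M X p t) \<le> xstar M X"
        \<comment> \<open>The infimum is below every value at positive \<open>t\<close>, hence below
          their limit at 0.\<close>
        by (rule tendsto_lowerbound[OF lim])
          (auto simp: eventually_at_right_field intro!: exI[of _ 1] INF_lower)
      show "xstar M X \<le> (INF t\<in>{0<..}. Binf M X p t)"
        using Binf_greater_xstar[OF facts] by (intro INF_greatest) (auto intro: less_imp_le)
    qed
  qed
qed

end
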